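(* Let $\mathcal P$ be the $\mathcal P$-map. Let $\mathcal R_2^-$ be the map on $\mathbb R^{3n}\times\mathbb R^{3n}$ which changes the sign of the second component of every $y^{(j)}\in\mathbb R^3$ and every $x^{(j)}\in\mathbb R^3$, $j=1,\ldots,n$, and let $$\mathcal S^-(\Theta,\chi,\Lambda,\vartheta,\kappa,\ell):=(-\Theta,\chi,\Lambda,-\vartheta,\kappa,\ell).$$ Then $$\mathcal R_2^-\circ\mathcal P=\mathcal P\circ\mathcal S^- .$$ Therefore, if a Hamiltonian $\mathrm H=\mathrm H(y,x)$ satisfies $\mathrm H\circ\mathcal R_2^-=\mathrm H$, then $\mathrm H_{\mathcal P}:=\mathrm H\circ\mathcal P$ satisfies $\mathrm H_{\mathcal P}\circ\mathcal S^-=\mathrm H_{\mathcal P}$. Hence any of the points $$\Theta_0=\cdots=\Theta_{n-1}=0,\qquad (\vartheta_0,\ldots,\vartheta_{n-1})=(k_0,\ldots,k_{n-1})\pi\mod 2\pi\mathbb Z^n\qquad (k_0,\ldots,k_{n-1}\in\mathbb Z)$$ is an equilibrium point (in the variables $(\Theta,\vartheta)$) for $\mathrm H_{\mathcal P}$, for any $(\chi,\Lambda,\kappa,\ell)$.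
   Context: Fix positive mass parameters $\mathfrak m_1,\ldots,\mathfrak m_n,\mathfrak M_1,\ldots,\mathfrak M_n$; $\mathbb T=\mathbb R/2\pi\mathbb Z$; $k^{(1)},k^{(2)},k^{(3)}$ is the standard basis of $\mathbb R^3$; $\mathcal R_1(\theta),\mathcal R_3(\theta)$ are the rotation matrices $\mathcal R_1(\theta)=\begin{pmatrix}1&0&0\\0&\cos\theta&-\sin\theta\\0&\sin\theta&\cos\theta\end{pmatrix}$, $\mathcal R_3(\theta)=\begin{pmatrix}\cos\theta&-\sin\theta&0\\ \sin\theta&\cos\theta&0\\0&0&1\end{pmatrix}$. Let $\mathfrak X_{\mathcal P}\subset\mathbb R^n\times\mathbb R_+^n\times\mathbb R_+^n\times\mathbb T^n\times\mathbb T^n$ be the set of $(\Theta,\chi,\Lambda,\vartheta,\kappa)$, with $\Theta=(\Theta_0,\ldots,\Theta_{n-1})$, $\chi=(\chi_0,\ldots,\chi_{n-1})$, $\Lambda=(\Lambda_1,\ldots,\Lambda_n)$, $\vartheta=(\vartheta_0,\ldots,\vartheta_{n-1})$, $\kappa=(\kappa_0,\ldots,\kappa_{n-1})$, such that $|\Theta_0|<\chi_0$, $0<\chi_{n-1}<\Lambda_n$ and, for $i=1,\ldots,n-1$, $|\Theta_i|<\min(\chi_{i-1},\chi_i)$, $(\chi_{i-1}-\chi_i,\vartheta_i)\ne(0,\pi)$ and $\sqrt{\chi_{i-1}^2+\chi_i^2-2\Theta_i^2+2\sqrt{(\chi_i^2-\Theta_i^2)(\chi_{i-1}^2-\Theta_i^2)}\cos\vartheta_i}<\Lambda_i$.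 For a point of $\mathfrak X_{\mathcal P}$ put $\Theta_n:=0$, $\chi_n:=0$, define $\iota_j,\mathrm i_j\in(0,\pi)$ by $\cos\iota_j=\Theta_{j-1}/\chi_{j-1}$, $\cos\mathrm i_j=\Theta_j/\chi_{j-1}$ and set $\mathrm T_j=\mathcal R_3(\vartheta_{j-1})\mathcal R_1(\iota_j)$, $\mathrm S_j=\mathcal R_3(\kappa_{j-1})\mathcal R_1(\mathrm i_j)$, $1\le j\le n$. Let $$\mathrm C^{(j)}_{\mathcal P}=\mathrm T_1\mathrm S_1\cdots\mathrm T_{j-1}\mathrm S_{j-1}\mathrm T_j\big(\chi_{j-1}k^{(3)}-\chi_j\mathrm S_j\mathrm T_{j+1}k^{(3)}\big)$$ (the second term being absent for $j=n$), and $$a_j=\frac1{\mathfrak M_j}\Big(\frac{\Lambda_j}{\mathfrak m_j}\Big)^2,\quad e_j=\sqrt{1-\frac{\|\mathrm C^{(j)}_{\mathcal P}\|^2}{\Lambda_j^2}},\quad N^{(j)}=\frac{\mathrm C^{(j)}_{\mathcal P}}{\|\mathrm C^{(j)}_{\mathcal P}\|},\quad P^{(j)}=\mathrm T_1\mathrm S_1\cdots\mathrm T_j\mathrm S_jk^{(3)},\quad Q^{(j)}=N^{(j)}\times P^{(j)}.$$ The $\mathcal P$-map $\mathcal P:(\Theta,\chi,\Lambda,\vartheta,\kappa,\ell)\in\mathfrak X_{\mathcal P}\times\mathbb T^n\mapsto(y,x)\in\mathbb R^{3n}\times\mathbb R^{3n}$, $y=(y^{(1)},\ldots,y^{(n)})$,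 $x=(x^{(1)},\ldots,x^{(n)})$, is defined as follows: with $\zeta_j$ the solution of $\zeta_j-e_j\sin\zeta_j=\ell_j$, $$x^{(j)}=a_j(\cos\zeta_j-e_j)P^{(j)}+a_j\sqrt{1-e_j^2}\,\sin\zeta_j\,Q^{(j)},$$ $$y^{(j)}=-\mathfrak m_j\sqrt{\frac{\mathfrak M_j}{a_j}}\frac{\sin\zeta_j}{1-e_j\cos\zeta_j}P^{(j)}+\mathfrak m_j\sqrt{\frac{\mathfrak M_j(1-e_j^2)}{a_j}}\frac{\cos\zeta_j}{1-e_j\cos\zeta_j}Q^{(j)}.$$ A Hamiltonian means a smooth function $\mathrm H$ on a domain of $\mathbb R^{3n}\times\mathbb R^{3n}$; points are understood to lie in the domain where $\mathrm H_{\mathcal P}$ is defined. That $(\Theta,\vartheta)=(\Theta^*,\vartheta^* )$ is an equilibrium point for $\mathrm H_{\mathcal P}$ for any $(\chi,\Lambda,\kappa,\ell)$ means that $\partial_\Theta\mathrm H_{\mathcal P}=\partial_\vartheta\mathrm H_{\mathcal P}=0$ at $(\Theta^*,\vartheta^* )$ for all such values of the remaining coordinates. *)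

theory Defs
  imports "HOL-Analysis.Analysis"
begin

section \<open>The circle of angles\<close>

quotient_type angle = real / "\<lambda>x y::real. \<exists>k::int. x - y = 2 * pi * of_int k"
  morphisms rep_angle of_radians
proof (rule equivpI)
  show "reflp (\<lambda>x y::real. \<exists>k::int. x - y = 2 * pi * of_int k)"
    by (rule reflpI) (rule exI[of _ 0], simp)
  show "symp (\<lambda>x y::real. \<exists>k::int. x - y = 2 * pi * of_int k)"
  proof (rule sympI)
    fix x y :: real
    assume "\<exists>k::int. x - y = 2 * pi * of_int k"
    then obtain k :: int where "x - y = 2 * pi * of_int k" ..
    then have "y - x = 2 * pi * of_int (- k)" by simp
    then show "\<exists>k::int. y - x = 2 * pi * of_int k" ..
  qed
  show "transp (\<lambda>x y::real. \<exists>k::int. x - y = 2 * pi * of_int k)"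
  proof (rule transpI)
    fix x y z :: real
    assume "\<exists>k::int. x - y = 2 * pi * of_int k" "\<exists>k::int. y - z = 2 * pi * of_int k"
    then obtain k l :: int where "x - y = 2 * pi * of_int k" "y - z = 2 * pi * of_int l" by blast
    then have "x - z = 2 * pi * of_int (k + l)" by (simp add: algebra_simps)
    then show "\<exists>k::int. x - z = 2 * pi * of_int k" ..
  qed
qed

instantiation angle :: ab_group_add
begin

lift_definition zero_angle :: angle is "0 :: real" .

lift_definition plus_angle :: "angle \<Rightarrow> angle \<Rightarrow> angle" is "(+) :: real \<Rightarrow> real \<Rightarrow> real"
proof -
  fix x x' y y' :: real
  assume "\<exists>k::int. x - x' = 2 * pi * of_int k" "\<exists>k::int. y - y' = 2 * pi * of_int k"
  then obtain k l :: int where "x - x' = 2 * pi * of_int k" "y - y' = 2 * pi * of_int l" by blast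
  then have "(x + y) - (x' + y') = 2 * pi * of_int (k + l)" by (simp add: algebra_simps)
  then show "\<exists>k::int. (x + y) - (x' + y') = 2 * pi * of_int k" ..
qed

lift_definition uminus_angle :: "angle \<Rightarrow> angle" is "uminus :: real \<Rightarrow> real"
proof -
  fix x x' :: real
  assume "\<exists>k::int. x - x' = 2 * pi * of_int k"
  then obtain k :: int where "x - x' = 2 * pi * of_int k" ..
  then have "- x - - x' = 2 * pi * of_int (- k)" by simp
  then show "\<exists>k::int. - x - - x' = 2 * pi * of_int k" ..
qed

definition minus_angle :: "angle \<Rightarrow> angle \<Rightarrow> angle"
  where "minus_angle a b = a + (- b)"

instance
proof
  fix a b c :: angle
  show "a + b + c = a + (b + c)" by transfer (rule exI[of _ 0], simp)
  show "a + b = b + a" by transfer (rule exI[of _ 0], simp)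
  show "0 + a = a" by transfer (rule exI[of _ 0], simp)
  show "- a + a = 0" by transfer (rule exI[of _ 0], simp)
  show "a - b = a + - b" by (rule minus_angle_def)
qed

end

lift_definition cos_angle :: "angle \<Rightarrow> real" is cos
proof -
  fix x y :: real
  assume "\<exists>k::int. x - y = 2 * pi * of_int k"
  then obtain k :: int where "x = y + 2 * pi * of_int k" by (auto simp: algebra_simps)
  then show "cos x = cos y"
    by (simp add: cos_add sin_int_2pin cos_int_2pin)
qed

lift_definition sin_angle :: "angle \<Rightarrow> real" is sin
proof -
  fix x y :: real
  assume "\<exists>k::int. x - y = 2 * pi * of_int k"
  then obtain k :: int where "x = y + 2 * pi * of_int k" by (auto simp: algebra_simps)
  then show "sin x = sin y"
    by (simp add: sin_add sin_int_2pin cos_int_2pin)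
qed


section \<open>Tuples\<close>

text \<open>
  The number of bodies is \<open>n = CARD('n)\<close>, and an \<open>n\<close>-tuple is a vector indexed by \<open>'n\<close> whose
  positions \<open>0, \<dots>, n - 1\<close> are numbered by \<^term>\<open>from_nat_into UNIV\<close>. So the entry
  \<open>\<Theta>\<^sub>i\<close> of \<open>\<Theta> = (\<Theta>\<^sub>0, \<dots>, \<Theta>\<^sub>n\<^sub>-\<^sub>1)\<close> (likewise for \<open>chi\<close>, \<open>\<theta>\<close>, \<open>\<kappa>\<close>) is \<open>ent \<Theta> i\<close>, whereas
  \<open>\<Lambda>\<^sub>j\<close> of \<open>\<Lambda> = (\<Lambda>\<^sub>1, \<dots>, \<Lambda>\<^sub>n)\<close> (likewise for \<open>l\<close>, the masses, and the vectors \<open>y\<close>, \<open>x\<close>) is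
  \<open>ent \<Lambda> (j - 1)\<close>. The value \<open>0\<close> beyond the last position encodes the conventions
  \<open>\<Theta>\<^sub>n = 0\<close> and \<open>chi\<^sub>n = 0\<close>.
\<close>

definition ent :: "'a::zero ^ 'n::finite \<Rightarrow> nat \<Rightarrow> 'a" where
  "ent v i = (if i < CARD('n) then v $ from_nat_into UNIV i else 0)"

definition tuple1 :: "(nat \<Rightarrow> 'a) \<Rightarrow> 'a ^ 'n::finite" where
  "tuple1 f = (\<chi> p. f (to_nat_on (UNIV :: 'n set) p + 1))"
  \<comment> \<open>the tuple \<open>(f 1, \<dots>, f n)\<close>\<close>


section \<open>The domain of the \<open>\<P>\<close>-map\<close>

text \<open>The variables are \<open>(\<Theta>, chi, \<Lambda>, \<theta>, \<kappa>, l)\<close>, where \<open>\<theta>\<close> is the angle tuple conjugate to \<open>\<Theta>\<close>;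
  points of phase space are \<open>(y, x)\<close>.\<close>

type_synonym 'n coords5 =
  "(real^'n) \<times> (real^'n) \<times> (real^'n) \<times> (angle^'n) \<times> (angle^'n)"

type_synonym 'n coords =
  "(real^'n) \<times> (real^'n) \<times> (real^'n) \<times> (angle^'n) \<times> (angle^'n) \<times> (angle^'n)"

type_synonym 'n phase = "((real^3)^'n) \<times> ((real^3)^'n)"

definition X_P :: "'n::finite coords5 set" where
  "X_P = {(\<Theta>, chi, \<Lambda>, \<theta>, \<kappa>).
     (\<forall>i<CARD('n). 0 < ent chi i) \<and> (\<forall>j\<in>{1..CARD('n)}. 0 < ent \<Lambda> (j - 1)) \<and>
     \<bar>ent \<Theta> 0\<bar> < ent chi 0 \<and>
     0 < ent chi (CARD('n) - 1) \<and> ent chi (CARD('n) - 1) < ent \<Lambda> (CARD('n) - 1) \<and>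
     (\<forall>i\<in>{1..CARD('n) - 1}.
        \<bar>ent \<Theta> i\<bar> < min (ent chi (i - 1)) (ent chi i) \<and>
        (ent chi (i - 1) - ent chi i, ent \<theta> i) \<noteq> (0, of_radians pi) \<and>
        sqrt ((ent chi (i - 1))\<^sup>2 + (ent chi i)\<^sup>2 - 2 * (ent \<Theta> i)\<^sup>2
              + 2 * sqrt (((ent chi i)\<^sup>2 - (ent \<Theta> i)\<^sup>2) * ((ent chi (i - 1))\<^sup>2 - (ent \<Theta> i)\<^sup>2))
                  * cos_angle (ent \<theta> i))
          < ent \<Lambda> (i - 1))}"

definition P_domain :: "'n::finite coords set" where
  "P_domain = {(\<Theta>, chi, \<Lambda>, \<theta>, \<kappa>, l). (\<Theta>, chi, \<Lambda>, \<theta>, \<kappa>) \<in> X_P}"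
  \<comment> \<open>the product of \<open>X_P\<close> and the torus of all \<open>l\<close>\<close>


section \<open>The \<open>\<P>\<close>-map\<close>

definition k3 :: "real^3" where
  "k3 = axis 3 1"

definition R1 :: "real \<Rightarrow> real^3^3" where
  "R1 t = vector [vector [1, 0, 0], vector [0, cos t, - sin t], vector [0, sin t, cos t]]"

definition R3 :: "angle \<Rightarrow> real^3^3" where
  "R3 t = vector [vector [cos_angle t, - sin_angle t, 0],
                  vector [sin_angle t, cos_angle t, 0], vector [0, 0, 1]]"

definition iota :: "real^'n::finite \<Rightarrow> real^'n \<Rightarrow> nat \<Rightarrow> real" where
  "iota \<Theta> chi j = arccos (ent \<Theta> (j - 1) / ent chi (j - 1))"

definition incl :: "real^'n::finite \<Rightarrow> real^'n \<Rightarrow> nat \<Rightarrow> real" where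
  "incl \<Theta> chi j = arccos (ent \<Theta> j / ent chi (j - 1))"

definition T_mat :: "real^'n::finite \<Rightarrow> real^'n \<Rightarrow> angle^'n \<Rightarrow> nat \<Rightarrow> real^3^3" where
  "T_mat \<Theta> chi \<theta> j = R3 (ent \<theta> (j - 1)) ** R1 (iota \<Theta> chi j)"

definition S_mat :: "real^'n::finite \<Rightarrow> real^'n \<Rightarrow> angle^'n \<Rightarrow> nat \<Rightarrow> real^3^3" where
  "S_mat \<Theta> chi \<kappa> j = R3 (ent \<kappa> (j - 1)) ** R1 (incl \<Theta> chi j)"

text \<open>\<open>TS_prod \<Theta> chi \<theta> \<kappa> j\<close> is the product \<open>T\<^sub>1 S\<^sub>1 \<cdots> T\<^sub>j S\<^sub>j\<close>.\<close>

primrec TS_prod ::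
  "real^'n::finite \<Rightarrow> real^'n \<Rightarrow> angle^'n \<Rightarrow> angle^'n \<Rightarrow> nat \<Rightarrow> real^3^3" where
  "TS_prod \<Theta> chi \<theta> \<kappa> 0 = mat 1"
| "TS_prod \<Theta> chi \<theta> \<kappa> (Suc j) =
     TS_prod \<Theta> chi \<theta> \<kappa> j ** T_mat \<Theta> chi \<theta> (Suc j) ** S_mat \<Theta> chi \<kappa> (Suc j)"

definition C_vec ::
  "real^'n::finite \<Rightarrow> real^'n \<Rightarrow> angle^'n \<Rightarrow> angle^'n \<Rightarrow> nat \<Rightarrow> real^3" where
  "C_vec \<Theta> chi \<theta> \<kappa> j =
     (TS_prod \<Theta> chi \<theta> \<kappa> (j - 1) ** T_mat \<Theta> chi \<theta> j) *v
       (ent chi (j - 1) *\<^sub>R k3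
        - (if j = CARD('n) then 0
           else ent chi j *\<^sub>R ((S_mat \<Theta> chi \<kappa> j ** T_mat \<Theta> chi \<theta> (j + 1)) *v k3)))"

definition N_vec ::
  "real^'n::finite \<Rightarrow> real^'n \<Rightarrow> angle^'n \<Rightarrow> angle^'n \<Rightarrow> nat \<Rightarrow> real^3" where
  "N_vec \<Theta> chi \<theta> \<kappa> j = C_vec \<Theta> chi \<theta> \<kappa> j /\<^sub>R norm (C_vec \<Theta> chi \<theta> \<kappa> j)"

definition P_vec ::
  "real^'n::finite \<Rightarrow> real^'n \<Rightarrow> angle^'n \<Rightarrow> angle^'n \<Rightarrow> nat \<Rightarrow> real^3" where
  "P_vec \<Theta> chi \<theta> \<kappa> j = TS_prod \<Theta> chi \<theta> \<kappa> j *v k3"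

definition Q_vec ::
  "real^'n::finite \<Rightarrow> real^'n \<Rightarrow> angle^'n \<Rightarrow> angle^'n \<Rightarrow> nat \<Rightarrow> real^3" where
  "Q_vec \<Theta> chi \<theta> \<kappa> j = cross3 (N_vec \<Theta> chi \<theta> \<kappa> j) (P_vec \<Theta> chi \<theta> \<kappa> j)"

definition semi_axis :: "real^'n::finite \<Rightarrow> real^'n \<Rightarrow> real^'n \<Rightarrow> nat \<Rightarrow> real" where
  "semi_axis \<mm> \<MM> \<Lambda> j = 1 / ent \<MM> (j - 1) * (ent \<Lambda> (j - 1) / ent \<mm> (j - 1))\<^sup>2"

definition ecc ::
  "real^'n::finite \<Rightarrow> real^'n \<Rightarrow> real^'n \<Rightarrow> angle^'n \<Rightarrow> angle^'n \<Rightarrow> nat \<Rightarrow> real" where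
  "ecc \<Theta> chi \<Lambda> \<theta> \<kappa> j = sqrt (1 - (norm (C_vec \<Theta> chi \<theta> \<kappa> j))\<^sup>2 / (ent \<Lambda> (j - 1))\<^sup>2)"

definition kepler :: "real \<Rightarrow> angle \<Rightarrow> angle" where
  "kepler e l = (THE \<zeta>. \<zeta> - of_radians (e * sin_angle \<zeta>) = l)"
  \<comment> \<open>well defined for \<open>0 \<le> e < 1\<close>, which is the range of \<open>ecc\<close> on \<open>X_P\<close>\<close>

text \<open>Position and momentum of a body with parameters \<open>\<mm>, \<MM>\<close> on the Kepler ellipse with
  semi-major axis \<open>a\<close> and eccentricity \<open>e\<close>, at eccentric anomaly \<open>\<zeta>\<close>.\<close>

definition kepler_x ::
  "real \<Rightarrow> real \<Rightarrow> angle \<Rightarrow> real^3 \<Rightarrow> real^3 \<Rightarrow> real^3" where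
  "kepler_x a e \<zeta> P Q =
     (a * (cos_angle \<zeta> - e)) *\<^sub>R P + (a * sqrt (1 - e\<^sup>2) * sin_angle \<zeta>) *\<^sub>R Q"

definition kepler_y ::
  "real \<Rightarrow> real \<Rightarrow> real \<Rightarrow> real \<Rightarrow> angle \<Rightarrow> real^3 \<Rightarrow> real^3 \<Rightarrow> real^3" where
  "kepler_y \<mm> \<MM> a e \<zeta> P Q =
     (- \<mm> * sqrt (\<MM> / a) * (sin_angle \<zeta> / (1 - e * cos_angle \<zeta>))) *\<^sub>R P
     + (\<mm> * sqrt (\<MM> * (1 - e\<^sup>2) / a) * (cos_angle \<zeta> / (1 - e * cos_angle \<zeta>))) *\<^sub>R Q"

fun P_map :: "real^'n::finite \<Rightarrow> real^'n \<Rightarrow> 'n coords \<Rightarrow> 'n phase" where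
  "P_map \<mm> \<MM> (\<Theta>, chi, \<Lambda>, \<theta>, \<kappa>, l) =
     (let a = semi_axis \<mm> \<MM> \<Lambda>;
          e = ecc \<Theta> chi \<Lambda> \<theta> \<kappa>;
          \<zeta> = (\<lambda>j. kepler (e j) (ent l (j - 1)));
          P = P_vec \<Theta> chi \<theta> \<kappa>;
          Q = Q_vec \<Theta> chi \<theta> \<kappa>
      in (tuple1 (\<lambda>j. kepler_y (ent \<mm> (j - 1)) (ent \<MM> (j - 1)) (a j) (e j) (\<zeta> j) (P j) (Q j)),
          tuple1 (\<lambda>j. kepler_x (a j) (e j) (\<zeta> j) (P j) (Q j))))"


section \<open>The symmetries\<close>

definition flip2 :: "real^3 \<Rightarrow> real^3" where
  "flip2 v = vector [v $ 1, - v $ 2, v $ 3]"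

fun R2_minus :: "'n::finite phase \<Rightarrow> 'n phase" where
  "R2_minus (y, x) = ((\<chi> p. flip2 (y $ p)), (\<chi> p. flip2 (x $ p)))"

fun S_minus :: "'n::finite coords \<Rightarrow> 'n coords" where
  "S_minus (\<Theta>, chi, \<Lambda>, \<theta>, \<kappa>, l) = (- \<Theta>, chi, \<Lambda>, - \<theta>, \<kappa>, l)"


section \<open>Hamiltonians and equilibria\<close>

text \<open>\<open>Ck_on k U f\<close>, for open \<open>U\<close>: all partial derivatives of \<open>f\<close> up to order \<open>k\<close> exist
  and are continuous on \<open>U\<close>.\<close>

primrec Ck_on :: "nat \<Rightarrow> 'a::euclidean_space set \<Rightarrow> ('a \<Rightarrow> real) \<Rightarrow> bool" where
  "Ck_on 0 U f \<longleftrightarrow> continuous_on U f"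
| "Ck_on (Suc k) U f \<longleftrightarrow> (\<forall>z\<in>U. f differentiable (at z)) \<and>
     (\<forall>b\<in>Basis. Ck_on k U (\<lambda>z. frechet_derivative f (at z) b))"

definition smooth_on :: "'a::euclidean_space set \<Rightarrow> ('a \<Rightarrow> real) \<Rightarrow> bool" where
  "smooth_on U f \<longleftrightarrow> (\<forall>k. Ck_on k U f)"

definition hamiltonian :: "'n::finite phase set \<Rightarrow> ('n phase \<Rightarrow> real) \<Rightarrow> bool" where
  "hamiltonian U H \<longleftrightarrow> open U \<and> smooth_on U H"
  \<comment> \<open>\<open>H\<close> is a function on \<open>U\<close>; its values off \<open>U\<close> carry no meaning\<close>

definition HP_domain ::
  "real^'n::finite \<Rightarrow> real^'n \<Rightarrow> 'n phase set \<Rightarrow> 'n coords set" where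
  "HP_domain \<mm> \<MM> U = P_domain \<inter> P_map \<mm> \<MM> -` U"
  \<comment> \<open>where \<open>H \<circ> P_map \<mm> \<MM>\<close> is defined, for \<open>H\<close> defined on \<open>U\<close>\<close>

text \<open>The two conjuncts below are \<open>\<partial>F/\<partial>\<Theta>\<^sub>p = 0\<close> and \<open>\<partial>F/\<partial>\<theta>\<^sub>p = 0\<close>, existence included;
  \<open>D\<close> is the domain on which \<open>F\<close> is defined.\<close>

definition equilibrium ::
  "'n::finite coords set \<Rightarrow> ('n coords \<Rightarrow> real) \<Rightarrow> real^'n \<Rightarrow> angle^'n \<Rightarrow> bool" where
  "equilibrium D F \<Theta> \<theta> \<longleftrightarrow>
     (\<forall>chi \<Lambda> \<kappa> l. (\<Theta>, chi, \<Lambda>, \<theta>, \<kappa>, l) \<in> D \<longrightarrow>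
        (\<forall>p. ((\<lambda>s. F (\<Theta> + axis p s, chi, \<Lambda>, \<theta>, \<kappa>, l)) has_real_derivative 0) (at 0) \<and>
             ((\<lambda>s. F (\<Theta>, chi, \<Lambda>, \<theta> + axis p (of_radians s), \<kappa>, l)) has_real_derivative 0) (at 0)))"

end

theory Submission
  imports Defs
begin

text \<open>
  Let \<open>D = diag(1, -1, 1)\<close> and \<open>E = diag(1, 1, -1)\<close>. Changing the signs of \<open>\<Theta>\<close> and \<open>\<theta>\<close> replaces the
  inclinations by their supplements, which turns \<open>T\<^sub>j\<close> into \<open>D T\<^sub>j E\<close> and \<open>S\<^sub>j\<close> into \<open>E S\<^sub>j D\<close>. So
  \<open>P\<close> becomes \<open>D P\<close>, \<open>C\<close> becomes \<open>- D C\<close> because \<open>E k3 = - k3\<close>, and \<open>Q\<close> becomes \<open>D Q\<close> because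
  \<open>det D = -1\<close>; the eccentricities do not change.

  The coordinate lines through \<open>(0, k \<pi>)\<close> are odd curves for the involution, so an invariant
  Hamiltonian is even along them, and an even differentiable function has derivative \<open>0\<close> at \<open>0\<close>.
\<close>

section \<open>Reflections and rotations\<close>

text \<open>This is the matrix of \<open>flip2\<close>; in matrix form the reflection can be
  multiplied with the rotations.\<close>

definition refl2 :: "real^3^3" where
  "refl2 = vector [vector [1, 0, 0], vector [0, - 1, 0], vector [0, 0, 1]]"

definition refl3 :: "real^3^3" where
  "refl3 = vector [vector [1, 0, 0], vector [0, 1, 0], vector [0, 0, - 1]]"

lemma matrix_mult_3:
  "((A :: real^3^3) ** B) $ i $ j = A $ i $ 1 * B $ 1 $ j + A $ i $ 2 * B $ 2 $ j + A $ i $ 3 * B $ 3 $ j"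
  by (simp add: matrix_matrix_mult_def sum_3)

lemma matrix_vector_mult_3:
  "((A :: real^3^3) *v v) $ i = A $ i $ 1 * v $ 1 + A $ i $ 2 * v $ 2 + A $ i $ 3 * v $ 3"
  by (simp add: matrix_vector_mult_def sum_3)

lemmas matrix_3_simps =
  vec_eq_iff forall_3 matrix_mult_3 matrix_vector_mult_3 refl2_def refl3_def R1_def R3_def

section \<open>Trigonometry and negation on the circle of angles\<close>

lemma cos_angle_minus [simp]: "cos_angle (- t) = cos_angle t"
  by transfer simp

lemma sin_angle_minus [simp]: "sin_angle (- t) = - sin_angle t"
  by transfer simp

lemma cos_angle_of_radians [simp]: "cos_angle (of_radians x) = cos x"
  by transfer simp

lemma sin_angle_of_radians [simp]: "sin_angle (of_radians x) = sin x"
  by transfer simp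

lemma cos_angle_add: "cos_angle (a + b) = cos_angle a * cos_angle b - sin_angle a * sin_angle b"
  by transfer (simp add: cos_add)

lemma sin_angle_add: "sin_angle (a + b) = sin_angle a * cos_angle b + cos_angle a * sin_angle b"
  by transfer (simp add: sin_add)

lemma sin_cos_angle_squared: "(sin_angle t)\<^sup>2 + (cos_angle t)\<^sup>2 = 1"
  by transfer simp

lemma of_radians_eq_iff: "of_radians x = of_radians y \<longleftrightarrow> (\<exists>k::int. x - y = 2 * pi * of_int k)"
  by (rule angle.abs_eq_iff)

lemma of_radians_add: "of_radians (x + y) = of_radians x + of_radians y"
  by (simp add: plus_angle.abs_eq)

lemma of_radians_minus: "of_radians (- x) = - of_radians x"
  by (simp add: uminus_angle.abs_eq)

lemma of_radians_0 [simp]: "of_radians 0 = 0"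
  by (simp add: zero_angle_def)

lemma of_radians_cases: obtains x where "a = of_radians x"
proof -
  have "\<exists>x. a = of_radians x"
    by (induct a rule: angle.abs_induct) blast
  with that show thesis by blast
qed

text \<open>Restates the angle excluded in \<open>X_P\<close> through the cosine, which is even and
  which enters the norm of \<open>C_vec\<close>.\<close>

lemma cos_angle_eq_minus_1: "cos_angle t = - 1 \<longleftrightarrow> t = of_radians pi"
proof (rule of_radians_cases[of t])
  fix x
  assume t: "t = of_radians x"
  have "cos x = - 1 \<longleftrightarrow> (\<exists>k::int. x = (2 * of_int k + 1) * pi)"
    using cos_eq_minus1[of x] by (simp add: algebra_simps)
  also have "\<dots> \<longleftrightarrow> (\<exists>k::int. x - pi = 2 * pi * of_int k)"
    by (simp add: algebra_simps)
  finally show ?thesis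
    by (simp add: t of_radians_eq_iff)
qed

text \<open>The two representatives differ by \<open>2 * pi * k\<close>, so multiples of
  \<open>pi\<close> are fixed by negation. This is what singles out the equilibria.\<close>

lemma minus_of_radians_multiple_pi: "- of_radians (of_int k * pi) = of_radians (of_int k * pi)"
  unfolding of_radians_minus[symmetric] of_radians_eq_iff
  by (rule exI[of _ "- k"]) simp

lemma minus_eq_of_radians_pi_iff: "- t = of_radians pi \<longleftrightarrow> t = of_radians pi"
  unfolding cos_angle_eq_minus_1[symmetric] by simp

section \<open>How the rotations interact with the two reflections\<close>

lemma refl2_mult_refl2 [simp]: "refl2 ** refl2 = mat 1"
  by (simp add: matrix_3_simps mat_def)

lemma refl3_mult_refl3 [simp]: "refl3 ** refl3 = mat 1"
  by (simp add: matrix_3_simps mat_def)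

text \<open>The mirror plane of \<open>refl2\<close> contains the rotation axis, so conjugation
  reverses the angle. The mirror plane of \<open>refl3\<close> is orthogonal to that axis, so
  \<open>refl3\<close> commutes with \<open>R3\<close>.\<close>

lemma R3_minus: "R3 (- t) = refl2 ** R3 t ** refl2"
  by (simp add: matrix_3_simps)

lemma R3_mult_refl3: "R3 t ** refl3 = refl3 ** R3 t"
  by (simp add: matrix_3_simps)

text \<open>Passing to the supplement negates the cosine and keeps the sine. Both placements of the
  reflections occur: this one for \<open>T_mat\<close>, the next for \<open>S_mat\<close>, so that
  the inner reflections cancel in the product.\<close>

lemma R1_pi_minus: "R1 (pi - t) = refl2 ** R1 t ** refl3"
  by (simp add: matrix_3_simps)

lemma R1_pi_minus': "R1 (pi - t) = refl3 ** R1 t ** refl2"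
  by (simp add: matrix_3_simps)

lemma refl3_k3 [simp]: "refl3 *v k3 = - k3"
  by (simp add: matrix_3_simps k3_def axis_def)

lemma refl2_k3 [simp]: "refl2 *v k3 = k3"
  by (simp add: matrix_3_simps k3_def axis_def)

lemma flip2_eq_refl2: "flip2 v = refl2 *v v"
  by (simp add: matrix_3_simps flip2_def)

lemma norm_refl2 [simp]: "norm (refl2 *v v) = norm v"
  by (simp add: norm_vec_def L2_set_def sum_3 matrix_vector_mult_3 refl2_def)

text \<open>The sign is the determinant of \<open>refl2\<close>; it will cancel the sign picked up
  by \<open>C_vec\<close>.\<close>

lemma cross3_refl2: "cross3 (refl2 *v v) (refl2 *v w) = - (refl2 *v cross3 v w)"
  by (simp add: matrix_3_simps cross3_def)

section \<open>Orthogonality of the rotations, and their dependence on cosine and sine\<close>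

lemma orthogonal_matrix_R1: "orthogonal_matrix (R1 t)"
  unfolding orthogonal_matrix
  by (simp add: matrix_3_simps mat_def transpose_def power2_eq_square[symmetric] algebra_simps)

lemma orthogonal_matrix_R3: "orthogonal_matrix (R3 t)"
  unfolding orthogonal_matrix using sin_cos_angle_squared[of t]
  by (simp add: matrix_3_simps mat_def transpose_def power2_eq_square[symmetric] algebra_simps)

lemma norm_orthogonal_matrix:
  "orthogonal_matrix (A :: real^'n^'n) \<Longrightarrow> norm (A *v v) = norm v"
  by (metis matrix_of_matrix_vector_mul matrix_vector_mul_linear orthogonal_transformation_matrix
      orthogonal_transformation_norm)

text \<open>With constant matrices and scalar coefficients, differentiability of a rotation reduces
  to that of the cosine and sine of its angle.\<close>

lemma R1_matrix_eq: "R1 t = mat 1 + (cos t - 1) *\<^sub>R (\<chi> i j. if i = j \<and> i \<noteq> 1 then 1 else 0)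
    + sin t *\<^sub>R (\<chi> i j. if i = 3 \<and> j = 2 then 1 else if i = 2 \<and> j = 3 then - 1 else 0)"
  by (simp add: matrix_3_simps mat_def)

lemma R3_matrix_eq: "R3 t = mat 1 + (cos_angle t - 1) *\<^sub>R (\<chi> i j. if i = j \<and> i \<noteq> 3 then 1 else 0)
    + sin_angle t *\<^sub>R (\<chi> i j. if i = 2 \<and> j = 1 then 1 else if i = 1 \<and> j = 2 then - 1 else 0)"
  by (simp add: matrix_3_simps mat_def)

section \<open>Differentiability\<close>

lemma bounded_bilinear_matrix_mult: "bounded_bilinear ((**) :: real^3^3 \<Rightarrow> real^3^3 \<Rightarrow> real^3^3)"
  unfolding bilinear_conv_bounded_bilinear[symmetric] bilinear_def linear_iff
  by (simp add: vec_eq_iff matrix_mult_3 algebra_simps)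

lemma bounded_bilinear_matrix_vector_mult: "bounded_bilinear ((*v) :: real^3^3 \<Rightarrow> real^3 \<Rightarrow> real^3)"
  unfolding bilinear_conv_bounded_bilinear[symmetric] bilinear_def linear_iff
  by (simp add: vec_eq_iff matrix_vector_mult_3 algebra_simps)

lemma bounded_bilinear_differentiable:
  assumes "bounded_bilinear h" "f differentiable (at x)" "g differentiable (at x)"
  shows "(\<lambda>x. h (f x) (g x)) differentiable (at x)"
proof -
  obtain f' g' where "(f has_derivative f') (at x)" "(g has_derivative g') (at x)"
    using assms(2,3) unfolding differentiable_def by blast
  from bounded_bilinear.FDERIV[OF assms(1) this] show ?thesis
    by (rule differentiableI)
qed

lemmas differentiable_matrix_mult = bounded_bilinear_differentiable[OF bounded_bilinear_matrix_mult]
lemmas differentiable_matrix_vector_mult =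
  bounded_bilinear_differentiable[OF bounded_bilinear_matrix_vector_mult]
lemmas differentiable_cross3 =
  bounded_bilinear_differentiable[OF bilinear_cross[unfolded bilinear_conv_bounded_bilinear]]

lemma differentiable_vec_lambda:
  fixes f :: "real \<Rightarrow> 'n::finite \<Rightarrow> 'b::euclidean_space"
  assumes "\<And>p. (\<lambda>s. f s p) differentiable (at x)"
  shows "(\<lambda>s. \<chi> p. f s p) differentiable (at x)"
proof -
  have "(\<lambda>s. (\<chi> p. f s p) \<bullet> b) differentiable (at x)" if "b \<in> Basis" for b
  proof -
    from that obtain p u where b: "b = axis p u"
      unfolding Basis_vec_def by blast
    show ?thesis
      using assms[of p] by (simp add: b inner_axis)
  qed
  then show ?thesis
    by (subst differentiable_componentwise_within) auto
qed

text \<open>Reflecting the argument turns a derivative \<open>d\<close> at 0 into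
  \<open>- d\<close>. Evenness is asked only near 0, where the curves considered later are under
  control.\<close>

lemma has_real_derivative_0_of_even:
  fixes f :: "real \<Rightarrow> real"
  assumes "f differentiable (at 0)" and "\<forall>\<^sub>F s in nhds 0. f (- s) = f s"
  shows "(f has_real_derivative 0) (at 0)"
proof -
  obtain d where d: "(f has_real_derivative d) (at 0)"
    using assms(1) by (rule real_differentiableE)
  then have "((\<lambda>s. f (- s)) has_real_derivative - d) (at 0)"
    using DERIV_mirror[of f d 0] by simp
  with assms(2) have "(f has_real_derivative - d) (at 0)"
    using DERIV_cong_ev[OF refl, of "\<lambda>s. f (- s)" f 0 "- d" "- d"] by simp
  with d have "d = - d"
    by (rule DERIV_unique)
  with d show ?thesis by simp
qed

lemma differentiable_DERIV_compose:
  fixes g :: "real \<Rightarrow> real" and f :: "real \<Rightarrow> real"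
  assumes "DERIV g (f x) :> d" "f differentiable (at x)"
  shows "(\<lambda>s. g (f s)) differentiable (at x)"
proof -
  obtain c where "(f has_real_derivative c) (at x)"
    using assms(2) by (rule real_differentiableE)
  from DERIV_chain2[OF assms(1) this] show ?thesis
    by (auto simp: real_differentiable_def)
qed

section \<open>Kepler's equation\<close>

lemma abs_sin_diff_le: "\<bar>sin x - sin y\<bar> \<le> \<bar>x - y :: real\<bar>"
proof -
  have "\<bar>sin x - sin y\<bar> = 2 * \<bar>sin ((x - y) / 2)\<bar> * \<bar>cos ((x + y) / 2)\<bar>"
    by (simp add: sin_diff_sin abs_mult)
  also have "\<dots> \<le> 2 * \<bar>(x - y) / 2\<bar> * 1"
    by (intro mult_mono mult_left_mono abs_sin_x_le_abs_x abs_cos_le_one) auto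
  finally show ?thesis by simp
qed

text \<open>Subtracting the two Kepler equations and using that sine is 1-Lipschitz, the term with
  factor \<open>e < 1\<close> is absorbed on the left. For \<open>e' = e\<close> this is uniqueness
  of the solution.\<close>

lemma kepler_lipschitz:
  fixes e e' z z' :: real
  assumes "0 \<le> e" "e < 1" and "z - e * sin z = z' - e' * sin z'"
  shows "\<bar>z' - z\<bar> \<le> \<bar>e' - e\<bar> / (1 - e)"
proof -
  have "z' - z = e * (sin z' - sin z) + (e' - e) * sin z'"
    using assms(3) by (simp add: algebra_simps)
  then have "\<bar>z' - z\<bar> \<le> e * \<bar>sin z' - sin z\<bar> + \<bar>e' - e\<bar> * \<bar>sin z'\<bar>"
    using assms(1) by (metis abs_mult abs_of_nonneg abs_triangle_ineq)
  also have "\<dots> \<le> e * \<bar>z' - z\<bar> + \<bar>e' - e\<bar> * 1"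
    using assms(1) abs_sin_diff_le[of z' z] by (intro add_mono mult_left_mono) auto
  finally have "\<bar>z' - z\<bar> * (1 - e) \<le> \<bar>e' - e\<bar>"
    by (simp add: algebra_simps)
  then show ?thesis
    using assms(2) by (simp add: pos_le_divide_eq)
qed

text \<open>Since \<open>e * sin z\<close> is bounded by 1, the intermediate value theorem applies
  on \<open>{L - 1..L + 1}\<close>.\<close>

lemma kepler_solution_exists:
  fixes e L :: real
  assumes "0 \<le> e" "e < 1"
  shows "\<exists>z. z - e * sin z = L"
proof -
  have "\<bar>e * sin t\<bar> \<le> 1" for t
    using assms by (simp add: abs_mult mult_le_one)
  then have "L - 1 - e * sin (L - 1) \<le> L" "L \<le> L + 1 - e * sin (L + 1)"
    by (smt (verit))+
  moreover have "continuous_on {L - 1..L + 1} (\<lambda>z. z - e * sin z)"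
    by (intro continuous_intros)
  ultimately show ?thesis
    using IVT'[of "\<lambda>z. z - e * sin z" "L - 1" L "L + 1"] by auto
qed

text \<open>Links the description on the circle, where calculus is not at hand, to a real
  lift.\<close>

lemma kepler_of_radians:
  assumes "0 \<le> e" "e < 1" and z: "z - e * sin z = L"
  shows "kepler e (of_radians L) = of_radians z"
  unfolding kepler_def
proof (rule the_equality)
  show "of_radians z - of_radians (e * sin_angle (of_radians z)) = of_radians L"
    unfolding diff_conv_add_uminus of_radians_minus[symmetric] of_radians_add[symmetric]
    by (simp add: z)
next
  fix \<zeta>
  assume \<zeta>: "\<zeta> - of_radians (e * sin_angle \<zeta>) = of_radians L"
  obtain w where w: "\<zeta> = of_radians w"
    by (rule of_radians_cases)
  have "of_radians (w - e * sin w) = of_radians L"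
    using \<zeta> unfolding w diff_conv_add_uminus of_radians_minus[symmetric] of_radians_add[symmetric]
    by simp
  then obtain k :: int where k: "w - e * sin w - L = 2 * pi * of_int k"
    unfolding of_radians_eq_iff by blast
  \<comment> \<open>The real equation for \<open>w\<close> holds up to a multiple of
    \<open>2 * pi\<close>. Shifting \<open>w\<close> by it keeps the sine and makes the equation
    exact, so uniqueness over the reals applies.\<close>
  define w' where "w' = w - 2 * pi * of_int k"
  have "sin w' = sin w"
    by (simp add: w'_def sin_diff sin_int_2pin cos_int_2pin)
  then have "z - e * sin z = w' - e * sin w'"
    using k z by (simp add: w'_def)
  then have "w' = z"
    using kepler_lipschitz[OF assms(1,2), of z w' e] by simp
  then show "\<zeta> = of_radians z"
    unfolding w of_radians_eq_iff w'_def by (auto intro: exI[of _ k])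
qed

text \<open>At a critical point of the eccentricity the eccentric anomaly is differentiable because it
  is Lipschitz in the eccentricity; no implicit function theorem is needed.\<close>

lemma kepler_differentiable:
  fixes e :: "real \<Rightarrow> real"
  assumes e: "(e has_real_derivative 0) (at 0)" and e0: "0 < e 0" "e 0 < 1"
  obtains z where "(z has_real_derivative 0) (at 0)"
    and "\<forall>\<^sub>F s in nhds 0. kepler (e s) l = of_radians (z s)"
proof -
  obtain L where L: "l = of_radians L"
    by (rule of_radians_cases)
  \<comment> \<open>The lift \<open>L\<close> is fixed, so all \<open>z s\<close> solve the same
    real equation up to the eccentricity, and the Lipschitz bound can compare them.\<close>
  define z where "z s = (SOME z. z - e s * sin z = L)" for s
  have z: "z s - e s * sin (z s) = L" if "0 \<le> e s" "e s < 1" for s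
    unfolding z_def using kepler_solution_exists[OF that] by (rule someI_ex)
  have "\<forall>\<^sub>F s in at 0. 0 < e s \<and> e s < 1"
    using DERIV_isCont[OF e] e0 unfolding isCont_def
    by (intro eventually_conj order_tendstoD[of e "e 0"])
  then have ev: "\<forall>\<^sub>F s in nhds 0. 0 < e s \<and> e s < 1"
    using e0 by (simp add: eventually_nhds_conv_at)
  \<comment> \<open>The Lipschitz bound divided by \<open>\<bar>s\<bar>\<close> will dominate the
    difference quotient of \<open>z\<close>; it vanishes in the limit because \<open>e\<close> is
    critical at 0.\<close>
  have "((\<lambda>s. (e s - e 0) / s) \<longlongrightarrow> 0) (at 0)"
    using e by (simp add: DERIV_def)
  then have lim: "((\<lambda>s. \<bar>(e s - e 0) / s\<bar> / (1 - e 0)) \<longlongrightarrow> 0) (at 0)"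
    by (intro tendsto_divide_zero tendsto_rabs_zero)
  have "((\<lambda>s. (z s - z 0) / s) \<longlongrightarrow> 0) (at 0)"
  proof (rule Lim_null_comparison[OF _ lim])
    have "\<bar>(z s - z 0) / s\<bar> \<le> \<bar>(e s - e 0) / s\<bar> / (1 - e 0)" if "0 < e s \<and> e s < 1" for s
    proof -
      have "\<bar>z s - z 0\<bar> \<le> \<bar>e s - e 0\<bar> / (1 - e 0)"
        using that e0 by (intro kepler_lipschitz) (simp_all add: z)
      then have "\<bar>z s - z 0\<bar> / \<bar>s\<bar> \<le> \<bar>e s - e 0\<bar> / (1 - e 0) / \<bar>s\<bar>"
        by (rule divide_right_mono) simp
      then show ?thesis
        by (simp add: abs_divide mult.commute)
    qed
    then show "\<forall>\<^sub>F s in at 0. norm ((z s - z 0) / s) \<le> \<bar>(e s - e 0) / s\<bar> / (1 - e 0)"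
      using ev by (auto simp: eventually_nhds_conv_at elim!: eventually_mono)
  qed
  then have "(z has_real_derivative 0) (at 0)"
    by (simp add: DERIV_def)
  moreover have "\<forall>\<^sub>F s in nhds 0. kepler (e s) l = of_radians (z s)"
    using ev by (rule eventually_mono) (simp add: L kepler_of_radians z)
  ultimately show ?thesis
    using that by blast
qed

section \<open>Equivariance of the map\<close>

lemma ent_minus [simp]: "ent (- v) i = - ent v i" for v :: "'a::ab_group_add ^ 'n::finite"
  by (simp add: ent_def)

text \<open>Puts all arguments of \<open>arccos\<close> in \<open>iota\<close> and
  \<open>incl\<close> for indices \<open>1, ..., n\<close> into \<open>[-1, 1]\<close>. It involves
  neither angles nor \<Lambda>, which makes it easy to verify along a curve near its base
  point.\<close>

definition admissible :: "real^'n::finite \<Rightarrow> real^'n \<Rightarrow> bool" where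
  "admissible \<Theta> chi \<longleftrightarrow>
     (\<forall>i<CARD('n). 0 < ent chi i \<and> \<bar>ent \<Theta> i\<bar> \<le> ent chi i \<and> \<bar>ent \<Theta> (Suc i)\<bar> \<le> ent chi i)"

lemma arccos_divide_minus:
  fixes t c :: real
  assumes "0 < c" "\<bar>t\<bar> \<le> c"
  shows "arccos (- t / c) = pi - arccos (t / c)"
proof -
  have "- 1 \<le> t / c" "t / c \<le> 1"
    using assms by (simp_all add: field_simps)
  then show ?thesis
    using arccos_minus by simp
qed

lemma refl2_refl2_mult [simp]: "refl2 ** (refl2 ** A) = A"
  by (simp add: matrix_mul_assoc)

lemma refl3_refl3_mult [simp]: "refl3 ** (refl3 ** A) = A"
  by (simp add: matrix_mul_assoc)

lemma refl2_refl2_vec [simp]: "refl2 *v (refl2 *v v) = v"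
  by (simp add: matrix_vector_mul_assoc)

lemma refl3_refl3_vec [simp]: "refl3 *v (refl3 *v v) = v"
  by (simp add: matrix_vector_mul_assoc)

lemma matrix_vector_mult_minus: "A *v (- v) = - (A *v v)" for A :: "real^3^3"
  by (simp add: vec_eq_iff matrix_vector_mult_3)

lemma kepler_x_refl2: "kepler_x a e \<zeta> (refl2 *v P) (refl2 *v Q) = flip2 (kepler_x a e \<zeta> P Q)"
  by (simp add: kepler_x_def flip2_eq_refl2 matrix_vector_right_distrib matrix_vector_mult_scaleR)

lemma kepler_y_refl2: "kepler_y m M a e \<zeta> (refl2 *v P) (refl2 *v Q) = flip2 (kepler_y m M a e \<zeta> P Q)"
  by (simp add: kepler_y_def flip2_eq_refl2 matrix_vector_right_distrib matrix_vector_mult_scaleR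
      del: scaleR_minus_left)

lemma to_nat_on_UNIV_less: "to_nat_on (UNIV :: 'n::finite set) p < CARD('n)"
  using to_nat_on_finite[OF finite_class.finite_UNIV] by (auto simp: bij_betw_def)

section \<open>Effect of the sign change on each ingredient of the map\<close>

context
  fixes \<Theta> chi :: "real^'n::finite"
  assumes adm: "admissible \<Theta> chi"
begin

lemma iota_minus: "j \<in> {1..CARD('n)} \<Longrightarrow> iota (- \<Theta>) chi j = pi - iota \<Theta> chi j"
  using adm unfolding iota_def admissible_def ent_minus
  by (intro arccos_divide_minus) auto

lemma incl_minus: "j \<in> {1..CARD('n)} \<Longrightarrow> incl (- \<Theta>) chi j = pi - incl \<Theta> chi j"
  using adm[unfolded admissible_def, rule_format, of "j - 1"] unfolding incl_def ent_minus
  by (intro arccos_divide_minus) auto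

lemma T_mat_minus:
  "j \<in> {1..CARD('n)} \<Longrightarrow> T_mat (- \<Theta>) chi (- \<theta>) j = refl2 ** T_mat \<Theta> chi \<theta> j ** refl3"
  by (simp add: T_mat_def iota_minus R3_minus R1_pi_minus matrix_mul_assoc[symmetric])

text \<open>The angle \<kappa> keeps its sign, so the left reflection from \<open>R1\<close> must be
  \<open>refl3\<close>, which can be moved across \<open>R3\<close>.\<close>

lemma S_mat_minus:
  assumes "j \<in> {1..CARD('n)}"
  shows "S_mat (- \<Theta>) chi \<kappa> j = refl3 ** S_mat \<Theta> chi \<kappa> j ** refl2"
  unfolding S_mat_def incl_minus[OF assms] R1_pi_minus' matrix_mul_assoc R3_mult_refl3 ..

lemma TS_prod_minus:
  "j \<le> CARD('n) \<Longrightarrow> TS_prod (- \<Theta>) chi (- \<theta>) \<kappa> j = refl2 ** TS_prod \<Theta> chi \<theta> \<kappa> j ** refl2"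
  by (induction j) (simp_all add: T_mat_minus S_mat_minus matrix_mul_assoc[symmetric])

text \<open>The prefix acquires \<open>refl2\<close> on the left and \<open>refl3\<close> on the
  right. Applied to either term in the bracket this right factor yields a minus sign, because
  \<open>refl3\<close> negates \<open>k3\<close>.\<close>

lemma C_vec_minus:
  assumes "j \<in> {1..CARD('n)}"
  shows "C_vec (- \<Theta>) chi (- \<theta>) \<kappa> j = - (refl2 *v C_vec \<Theta> chi \<theta> \<kappa> j)"
proof -
  \<comment> \<open>The index \<open>j + 1\<close> is in range exactly when the second term of
    \<open>C_vec\<close> is present.\<close>
  have "T_mat (- \<Theta>) chi (- \<theta>) (j + 1) = refl2 ** T_mat \<Theta> chi \<theta> (j + 1) ** refl3"
    if "j \<noteq> CARD('n)"
    using assms that by (intro T_mat_minus) auto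
  moreover have "TS_prod (- \<Theta>) chi (- \<theta>) \<kappa> (j - 1) = refl2 ** TS_prod \<Theta> chi \<theta> \<kappa> (j - 1) ** refl2"
    using assms by (intro TS_prod_minus) auto
  ultimately show ?thesis
    using assms
    by (simp add: C_vec_def T_mat_minus S_mat_minus matrix_vector_mul_assoc[symmetric]
        matrix_vector_mult_minus matrix_vector_mult_diff_distrib matrix_vector_right_distrib
        matrix_vector_mult_scaleR algebra_simps)
qed

lemma norm_C_vec_minus:
  "j \<in> {1..CARD('n)} \<Longrightarrow> norm (C_vec (- \<Theta>) chi (- \<theta>) \<kappa> j) = norm (C_vec \<Theta> chi \<theta> \<kappa> j)"
  by (simp add: C_vec_minus)

lemma ecc_minus:
  "j \<in> {1..CARD('n)} \<Longrightarrow> ecc (- \<Theta>) chi \<Lambda> (- \<theta>) \<kappa> j = ecc \<Theta> chi \<Lambda> \<theta> \<kappa> j"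
  by (simp add: ecc_def norm_C_vec_minus)

lemma P_vec_minus:
  "j \<le> CARD('n) \<Longrightarrow> P_vec (- \<Theta>) chi (- \<theta>) \<kappa> j = refl2 *v P_vec \<Theta> chi \<theta> \<kappa> j"
  by (simp add: P_vec_def TS_prod_minus matrix_vector_mul_assoc[symmetric])

text \<open>Two signs cancel: \<open>N_vec\<close> inherits the minus of \<open>C_vec\<close>, and
  the cross product contributes the determinant of \<open>refl2\<close>.\<close>

lemma Q_vec_minus:
  assumes "j \<in> {1..CARD('n)}"
  shows "Q_vec (- \<Theta>) chi (- \<theta>) \<kappa> j = refl2 *v Q_vec \<Theta> chi \<theta> \<kappa> j"
proof -
  have "N_vec (- \<Theta>) chi (- \<theta>) \<kappa> j = - (refl2 *v N_vec \<Theta> chi \<theta> \<kappa> j)"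
    using assms by (simp add: N_vec_def C_vec_minus matrix_vector_mult_scaleR)
  then show ?thesis
    using assms by (simp add: Q_vec_def P_vec_minus cross_minus_left cross3_refl2)
qed

text \<open>Semi-axes, eccentricities and anomalies are unchanged, and the orbit formulas are linear
  in \<open>P\<close> and \<open>Q\<close>, which are both reflected.\<close>

lemma P_map_minus:
  "P_map \<mm> \<MM> (- \<Theta>, chi, \<Lambda>, - \<theta>, \<kappa>, l) = R2_minus (P_map \<mm> \<MM> (\<Theta>, chi, \<Lambda>, \<theta>, \<kappa>, l))"
  by (simp add: Let_def tuple1_def to_nat_on_UNIV_less Suc_le_eq ecc_minus P_vec_minus Q_vec_minus
      kepler_x_refl2 kepler_y_refl2)

end

lemma X_P_admissible:
  fixes \<Theta> chi :: "real^'n::finite"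
  assumes "(\<Theta>, chi, \<Lambda>, \<theta>, \<kappa>) \<in> X_P"
  shows "admissible \<Theta> chi"
  unfolding admissible_def
proof (intro allI impI conjI)
  fix i assume i: "i < CARD('n)"
  show "0 < ent chi i"
    using assms i by (simp add: X_P_def)
  show "\<bar>ent \<Theta> i\<bar> \<le> ent chi i"
  proof (cases "i = 0")
    case True
    then show ?thesis
      using assms by (simp add: X_P_def)
  next
    case False
    then have "i \<in> {1..CARD('n) - 1}"
      using i by simp
    then have "\<bar>ent \<Theta> i\<bar> < min (ent chi (i - 1)) (ent chi i)"
      using assms unfolding X_P_def by blast
    then show ?thesis by simp
  qed
  show "\<bar>ent \<Theta> (Suc i)\<bar> \<le> ent chi i"
  proof (cases "Suc i < CARD('n)")
    case True
    then have "Suc i \<in> {1..CARD('n) - 1}" by simp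
    then have "\<bar>ent \<Theta> (Suc i)\<bar> < min (ent chi (Suc i - 1)) (ent chi (Suc i))"
      using assms unfolding X_P_def by blast
    then show ?thesis by simp
  next
    \<comment> \<open>Here \<open>Suc i\<close> is past the last position, where \<open>ent\<close>
      encodes the convention that the entry of \<Theta> is 0.\<close>
    case False
    then show ?thesis
      using \<open>0 < ent chi i\<close> by (simp add: ent_def)
  qed
qed

section \<open>The eccentricities\<close>

lemma orthogonal_matrix_T_mat: "orthogonal_matrix (T_mat \<Theta> chi \<theta> j)"
  by (simp add: T_mat_def orthogonal_matrix_mul orthogonal_matrix_R1 orthogonal_matrix_R3)

lemma orthogonal_matrix_S_mat: "orthogonal_matrix (S_mat \<Theta> chi \<kappa> j)"
  by (simp add: S_mat_def orthogonal_matrix_mul orthogonal_matrix_R1 orthogonal_matrix_R3)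

lemma orthogonal_matrix_TS_prod: "orthogonal_matrix (TS_prod \<Theta> chi \<theta> \<kappa> j)"
  by (induction j)
    (simp_all add: orthogonal_matrix_mul orthogonal_matrix_T_mat orthogonal_matrix_S_mat
      orthogonal_matrix_id)

lemma norm_k3 [simp]: "norm k3 = 1"
  by (simp add: k3_def)

lemma norm_C_vec:
  fixes \<Theta> chi :: "real^'n::finite"
  shows "norm (C_vec \<Theta> chi \<theta> \<kappa> j) = norm (ent chi (j - 1) *\<^sub>R k3
     - (if j = CARD('n) then 0
        else ent chi j *\<^sub>R ((S_mat \<Theta> chi \<kappa> j ** T_mat \<Theta> chi \<theta> (j + 1)) *v k3)))"
  unfolding C_vec_def
  by (intro norm_orthogonal_matrix orthogonal_matrix_mul orthogonal_matrix_TS_prod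
      orthogonal_matrix_T_mat)

lemma cos_arccos_divide:
  fixes t c :: real
  assumes "0 < c" "\<bar>t\<bar> \<le> c"
  shows "c * cos (arccos (t / c)) = t" and "c * sin (arccos (t / c)) = sqrt (c\<^sup>2 - t\<^sup>2)"
proof -
  have *: "- 1 \<le> t / c" "t / c \<le> 1"
    using assms by (simp_all add: field_simps)
  then show "c * cos (arccos (t / c)) = t"
    using assms by simp
  have "c * sin (arccos (t / c)) = sqrt (c\<^sup>2) * sqrt (1 - (t / c)\<^sup>2)"
    using * assms by (simp add: sin_arccos)
  also have "\<dots> = sqrt (c\<^sup>2 - t\<^sup>2)"
    unfolding real_sqrt_mult[symmetric] using assms by (simp add: right_diff_distrib power_divide)
  finally show "c * sin (arccos (t / c)) = sqrt (c\<^sup>2 - t\<^sup>2)" .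
qed

text \<open>Law of cosines for two vectors of lengths \<open>ent chi (j - 1)\<close> and
  \<open>ent chi j\<close>. The result is the radicand in the definition of
  \<open>X_P\<close>.\<close>

lemma norm_C_vec_squared:
  fixes \<Theta> chi :: "real^'n::finite"
  assumes "0 < ent chi (j - 1)" "\<bar>ent \<Theta> j\<bar> \<le> ent chi (j - 1)"
    and "0 < ent chi j" "\<bar>ent \<Theta> j\<bar> \<le> ent chi j" and "j < CARD('n)"
  shows "(norm (C_vec \<Theta> chi \<theta> \<kappa> j))\<^sup>2 = (ent chi (j - 1))\<^sup>2 + (ent chi j)\<^sup>2 - 2 * (ent \<Theta> j)\<^sup>2
    + 2 * sqrt (((ent chi j)\<^sup>2 - (ent \<Theta> j)\<^sup>2) * ((ent chi (j - 1))\<^sup>2 - (ent \<Theta> j)\<^sup>2))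
        * cos_angle (ent \<theta> j)"
proof -
  define w where "w = (S_mat \<Theta> chi \<kappa> j ** T_mat \<Theta> chi \<theta> (j + 1)) *v k3"
  have w: "norm w = 1"
    unfolding w_def
    by (simp add: norm_orthogonal_matrix orthogonal_matrix_mul orthogonal_matrix_T_mat
        orthogonal_matrix_S_mat)
  \<comment> \<open>The angle \<kappa> drops out because \<open>R3\<close> preserves the third
    coordinate; \<open>T_mat\<close> with index \<open>j + 1\<close> contributes the angle with
    index \<open>j\<close>.\<close>
  have w3: "w $ 3 = cos (incl \<Theta> chi j) * cos (iota \<Theta> chi (j + 1))
      - sin (incl \<Theta> chi j) * sin (iota \<Theta> chi (j + 1)) * cos_angle (ent \<theta> j)"
    by (simp add: w_def S_mat_def T_mat_def matrix_vector_mul_assoc[symmetric] matrix_3_simps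
        k3_def axis_def)
  have "ent chi (j - 1) * ent chi j * w $ 3
    = (ent chi (j - 1) * cos (incl \<Theta> chi j)) * (ent chi j * cos (iota \<Theta> chi (j + 1)))
      - (ent chi (j - 1) * sin (incl \<Theta> chi j)) * (ent chi j * sin (iota \<Theta> chi (j + 1)))
        * cos_angle (ent \<theta> j)"
    by (simp add: w3 algebra_simps)
  also have "\<dots> = (ent \<Theta> j)\<^sup>2 - sqrt (((ent chi j)\<^sup>2 - (ent \<Theta> j)\<^sup>2) * ((ent chi (j - 1))\<^sup>2 - (ent \<Theta> j)\<^sup>2))
        * cos_angle (ent \<theta> j)"
    using assms
    by (simp add: incl_def iota_def cos_arccos_divide real_sqrt_mult power2_eq_square
        del: cos_arccos)
  finally have *: "ent chi (j - 1) * ent chi j * w $ 3 = \<dots>" .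
  have "(norm (C_vec \<Theta> chi \<theta> \<kappa> j))\<^sup>2 = (norm (ent chi (j - 1) *\<^sub>R k3 - ent chi j *\<^sub>R w))\<^sup>2"
    using assms by (simp add: norm_C_vec w_def)
  also have "\<dots> = (ent chi (j - 1))\<^sup>2 * (norm k3)\<^sup>2 + (ent chi j)\<^sup>2 * (norm w)\<^sup>2
      - 2 * (ent chi (j - 1) * ent chi j * (k3 \<bullet> w))"
    unfolding power2_norm_eq_inner
    by (simp add: inner_diff_left inner_diff_right inner_commute algebra_simps power2_eq_square)
  also have "k3 \<bullet> w = w $ 3"
    by (simp add: k3_def inner_axis')
  finally show ?thesis
    unfolding w norm_k3 * by simp
qed

text \<open>For \<open>j < n\<close> the upper bound is the last inequality of \<open>X_P\<close>.
  Vanishing would force equal lengths and opposite directions, that is, the excluded pair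
  \<open>(0, pi)\<close>. For the last \<open>j\<close> the norm is the last entry of
  \<open>chi\<close>.\<close>

lemma norm_C_vec_bounds:
  fixes \<Theta> chi :: "real^'n::finite"
  assumes X: "(\<Theta>, chi, \<Lambda>, \<theta>, \<kappa>) \<in> X_P" and j: "j \<in> {1..CARD('n)}"
  shows "0 < norm (C_vec \<Theta> chi \<theta> \<kappa> j)" and "norm (C_vec \<Theta> chi \<theta> \<kappa> j) < ent \<Lambda> (j - 1)"
proof -
  let ?N = "norm (C_vec \<Theta> chi \<theta> \<kappa> j)"
  have "0 < ?N \<and> ?N < ent \<Lambda> (j - 1)"
  proof (cases "j = CARD('n)")
    case True
    then show ?thesis
      using X by (simp add: norm_C_vec X_P_def)
  next
    case False
    define c c' t where "c = ent chi (j - 1)" and "c' = ent chi j" and "t = ent \<Theta> j"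
    have "j \<in> {1..CARD('n) - 1}" "j < CARD('n)" "j - 1 < CARD('n)"
      using False j by auto
    then have c: "0 < c" "0 < c'" "\<bar>t\<bar> < c" "\<bar>t\<bar> < c'"
      and ne: "(c - c', ent \<theta> j) \<noteq> (0, of_radians pi)"
      and less: "sqrt (c\<^sup>2 + c'\<^sup>2 - 2 * t\<^sup>2 + 2 * sqrt ((c'\<^sup>2 - t\<^sup>2) * (c\<^sup>2 - t\<^sup>2)) * cos_angle (ent \<theta> j))
        < ent \<Lambda> (j - 1)"
      using X by (auto simp: X_P_def c_def c'_def t_def)
    have sq: "?N\<^sup>2 = c\<^sup>2 + c'\<^sup>2 - 2 * t\<^sup>2 + 2 * sqrt ((c'\<^sup>2 - t\<^sup>2) * (c\<^sup>2 - t\<^sup>2)) * cos_angle (ent \<theta> j)"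
      using c \<open>j < CARD('n)\<close> unfolding c_def c'_def t_def by (intro norm_C_vec_squared) auto
    then have "?N < ent \<Lambda> (j - 1)"
      using less by (metis norm_ge_zero real_sqrt_unique)
    moreover have "?N \<noteq> 0"
    proof
      assume 0: "?N = 0"
      then have "c *\<^sub>R k3 = c' *\<^sub>R ((S_mat \<Theta> chi \<kappa> j ** T_mat \<Theta> chi \<theta> (j + 1)) *v k3)"
        using False by (simp add: norm_C_vec c_def c'_def)
      \<comment> \<open>Both sides are multiples of unit vectors.\<close>
      from arg_cong[OF this, of norm] have "c = c'"
        using c by (simp add: norm_orthogonal_matrix orthogonal_matrix_mul orthogonal_matrix_T_mat
            orthogonal_matrix_S_mat)
      moreover have "t\<^sup>2 < c\<^sup>2"
        using c power_strict_mono[of "\<bar>t\<bar>" c 2] by simp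
      moreover from this have "sqrt ((c\<^sup>2 - t\<^sup>2) * (c\<^sup>2 - t\<^sup>2)) = c\<^sup>2 - t\<^sup>2"
        by simp
      ultimately have "2 * (c\<^sup>2 - t\<^sup>2) * (1 + cos_angle (ent \<theta> j)) = 0"
        using sq 0 by (simp only: distrib_left) simp
      with \<open>t\<^sup>2 < c\<^sup>2\<close> have "cos_angle (ent \<theta> j) = - 1"
        by simp
      with ne \<open>c = c'\<close> show False
        by (simp add: cos_angle_eq_minus_1)
    qed
    ultimately show ?thesis by simp
  qed
  then show "0 < ?N" and "?N < ent \<Lambda> (j - 1)" by auto
qed

text \<open>Strictness matters on both sides: the square root defining \<open>ecc\<close> has a
  positive radicand, and Kepler's equation stays nondegenerate.\<close>

lemma ecc_bounds:
  fixes \<Theta> chi :: "real^'n::finite"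
  assumes "(\<Theta>, chi, \<Lambda>, \<theta>, \<kappa>) \<in> X_P" and "j \<in> {1..CARD('n)}"
  shows "(norm (C_vec \<Theta> chi \<theta> \<kappa> j))\<^sup>2 / (ent \<Lambda> (j - 1))\<^sup>2 < 1"
    and "0 < ecc \<Theta> chi \<Lambda> \<theta> \<kappa> j" and "ecc \<Theta> chi \<Lambda> \<theta> \<kappa> j < 1"
proof -
  note b = norm_C_vec_bounds[OF assms]
  then have "(norm (C_vec \<Theta> chi \<theta> \<kappa> j))\<^sup>2 < (ent \<Lambda> (j - 1))\<^sup>2"
    by (intro power_strict_mono) auto
  moreover have pos: "0 < ent \<Lambda> (j - 1)"
    using b by (rule order.strict_trans)
  ultimately show "(norm (C_vec \<Theta> chi \<theta> \<kappa> j))\<^sup>2 / (ent \<Lambda> (j - 1))\<^sup>2 < 1"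
    by (simp add: divide_less_eq)
  then show "0 < ecc \<Theta> chi \<Lambda> \<theta> \<kappa> j"
    by (simp add: ecc_def)
  have "0 < (norm (C_vec \<Theta> chi \<theta> \<kappa> j))\<^sup>2 / (ent \<Lambda> (j - 1))\<^sup>2"
    using b(1) pos by (intro divide_pos_pos zero_less_power)
  then show "ecc \<Theta> chi \<Lambda> \<theta> \<kappa> j < 1"
    by (simp add: ecc_def)
qed

section \<open>Odd curves\<close>

text \<open>Treats the coordinate lines in \<Theta> and in \<theta> at once. Angles carry no
  differentiable structure here, so regularity of \<theta> is expressed through its cosine and
  sine.\<close>

locale odd_curve =
  fixes \<mm> \<MM> chi \<Lambda> :: "real^'n::finite" and \<kappa> l :: "angle^'n"
    and \<Theta> :: "real \<Rightarrow> real^'n" and \<theta> :: "real \<Rightarrow> angle^'n"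
  assumes mass_pos: "\<forall>p. 0 < \<mm> $ p" "\<forall>p. 0 < \<MM> $ p"
    and ent_differentiable: "(\<lambda>s. ent (\<Theta> s) i) differentiable (at 0)"
    and cos_differentiable: "(\<lambda>s. cos_angle (ent (\<theta> s) i)) differentiable (at 0)"
    and sin_differentiable: "(\<lambda>s. sin_angle (ent (\<theta> s) i)) differentiable (at 0)"
    and odd: "\<Theta> (- s) = - \<Theta> s" "\<theta> (- s) = - \<theta> s"
    and start: "(\<Theta> 0, chi, \<Lambda>, \<theta> 0, \<kappa>) \<in> X_P"
begin

lemma curve_0: "\<Theta> 0 = 0"
proof -
  have "\<Theta> 0 = - \<Theta> 0"
    using odd(1)[of 0] by simp
  then show ?thesis
    by (simp add: vec_eq_iff)
qed

lemma ent_curve_0 [simp]: "ent (\<Theta> 0) i = 0"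
  by (simp add: curve_0 ent_def)

text \<open>At 0 all entries of \<Theta> vanish while those of \<open>chi\<close> are positive;
  continuity and finiteness of the index set do the rest.\<close>

lemma eventually_admissible: "\<forall>\<^sub>F s in nhds 0. admissible (\<Theta> s) chi"
proof -
  have small: "\<forall>\<^sub>F s in nhds 0. \<bar>ent (\<Theta> s) k\<bar> \<le> ent chi i" if "i < CARD('n)" for i k
  proof -
    have pos: "0 < ent chi i"
      using start that by (simp add: X_P_def)
    have "isCont (\<lambda>s. ent (\<Theta> s) k) 0"
      by (rule differentiable_imp_continuous_within[OF ent_differentiable])
    then have "((\<lambda>s. \<bar>ent (\<Theta> s) k\<bar>) \<longlongrightarrow> \<bar>ent (\<Theta> 0) k\<bar>) (at 0)"
      unfolding isCont_def by (rule tendsto_rabs)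
    then have "\<forall>\<^sub>F s in at 0. \<bar>ent (\<Theta> s) k\<bar> < ent chi i"
      by (rule order_tendstoD) (simp add: pos)
    then have "\<forall>\<^sub>F s in at 0. \<bar>ent (\<Theta> s) k\<bar> \<le> ent chi i"
      by (rule eventually_mono) simp
    moreover have "\<bar>ent (\<Theta> 0) k\<bar> \<le> ent chi i"
      using pos by simp
    ultimately show ?thesis
      by (simp add: eventually_nhds_conv_at)
  qed
  have "\<forall>\<^sub>F s in nhds 0. \<forall>i\<in>{..<CARD('n)}. \<bar>ent (\<Theta> s) i\<bar> \<le> ent chi i \<and> \<bar>ent (\<Theta> s) (Suc i)\<bar> \<le> ent chi i"
    by (intro eventually_ball_finite ballI eventually_conj small) auto
  then show ?thesis
    using start by (auto simp: admissible_def X_P_def elim!: eventually_mono)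
qed

text \<open>The argument of \<open>arccos\<close> is 0 at the base point, away from the endpoints
  where \<open>arccos\<close> is singular. This covers \<open>c = 0\<close> too, as the quotient is
  then constantly 0.\<close>

lemma R1_arccos_differentiable: "(\<lambda>s. R1 (arccos (ent (\<Theta> s) i / c))) differentiable (at 0)"
proof -
  have "(\<lambda>s. ent (\<Theta> s) i * (1 / c)) differentiable (at 0)"
    by (intro differentiable_mult ent_differentiable differentiable_const)
  then have "(\<lambda>s. arccos (ent (\<Theta> s) i / c)) differentiable (at 0)"
    by (intro differentiable_DERIV_compose[OF DERIV_arccos]) simp_all
  then have "(\<lambda>s. cos (arccos (ent (\<Theta> s) i / c))) differentiable (at 0)"
    and "(\<lambda>s. sin (arccos (ent (\<Theta> s) i / c))) differentiable (at 0)"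
    by (rule differentiable_DERIV_compose[OF DERIV_cos] differentiable_DERIV_compose[OF DERIV_sin])+
  then show ?thesis
    unfolding R1_matrix_eq
    by (intro differentiable_add differentiable_scaleR differentiable_diff differentiable_const)
qed

lemma R3_differentiable: "(\<lambda>s. R3 (ent (\<theta> s) i)) differentiable (at 0)"
  unfolding R3_matrix_eq
  by (intro differentiable_add differentiable_scaleR differentiable_diff differentiable_const
      cos_differentiable sin_differentiable)

lemma T_mat_differentiable: "(\<lambda>s. T_mat (\<Theta> s) chi (\<theta> s) j) differentiable (at 0)"
  unfolding T_mat_def iota_def
  by (intro differentiable_matrix_mult R3_differentiable R1_arccos_differentiable)

lemma S_mat_differentiable: "(\<lambda>s. S_mat (\<Theta> s) chi \<kappa> j) differentiable (at 0)"
  unfolding S_mat_def incl_def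
  by (intro differentiable_matrix_mult differentiable_const R1_arccos_differentiable)

lemma TS_prod_differentiable: "(\<lambda>s. TS_prod (\<Theta> s) chi (\<theta> s) \<kappa> j) differentiable (at 0)"
  by (induction j)
    (simp_all add: differentiable_matrix_mult T_mat_differentiable S_mat_differentiable)

lemma P_vec_differentiable: "(\<lambda>s. P_vec (\<Theta> s) chi (\<theta> s) \<kappa> j) differentiable (at 0)"
  unfolding P_vec_def
  by (intro differentiable_matrix_vector_mult TS_prod_differentiable differentiable_const)

lemma C_vec_differentiable: "(\<lambda>s. C_vec (\<Theta> s) chi (\<theta> s) \<kappa> j) differentiable (at 0)"
  unfolding C_vec_def
  by (cases "j = CARD('n)")
    (simp_all add: differentiable_matrix_vector_mult differentiable_matrix_mult
      TS_prod_differentiable T_mat_differentiable S_mat_differentiable)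

context
  fixes j assumes j: "j \<in> {1..CARD('n)}"
begin

lemma norm_C_vec_differentiable: "(\<lambda>s. norm (C_vec (\<Theta> s) chi (\<theta> s) \<kappa> j)) differentiable (at 0)"
proof (rule differentiable_compose[OF _ C_vec_differentiable])
  show "norm differentiable at (C_vec (\<Theta> 0) chi (\<theta> 0) \<kappa> j)"
    using norm_C_vec_bounds(1)[OF start j] by (intro differentiable_norm_at) auto
qed

lemma Q_vec_differentiable: "(\<lambda>s. Q_vec (\<Theta> s) chi (\<theta> s) \<kappa> j) differentiable (at 0)"
  unfolding Q_vec_def N_vec_def
  using norm_C_vec_bounds(1)[OF start j]
  by (intro differentiable_cross3 P_vec_differentiable differentiable_scaleR differentiable_inverse
      norm_C_vec_differentiable C_vec_differentiable) auto

text \<open>The eccentricity is even along the curve, hence critical at 0, as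
  \<open>kepler_differentiable\<close> requires.\<close>

lemma ecc_has_derivative_0:
  "((\<lambda>s. ecc (\<Theta> s) chi \<Lambda> (\<theta> s) \<kappa> j) has_real_derivative 0) (at 0)"
proof (rule has_real_derivative_0_of_even)
  show "(\<lambda>s. ecc (\<Theta> s) chi \<Lambda> (\<theta> s) \<kappa> j) differentiable (at 0)"
    unfolding ecc_def
  proof (rule differentiable_DERIV_compose[OF DERIV_real_sqrt])
    show "0 < 1 - (norm (C_vec (\<Theta> 0) chi (\<theta> 0) \<kappa> j))\<^sup>2 / (ent \<Lambda> (j - 1))\<^sup>2"
      using ecc_bounds(1)[OF start j] by simp
    show "(\<lambda>s. 1 - (norm (C_vec (\<Theta> s) chi (\<theta> s) \<kappa> j))\<^sup>2 / (ent \<Lambda> (j - 1))\<^sup>2) differentiable (at 0)"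
      unfolding divide_inverse
      by (intro differentiable_diff differentiable_mult differentiable_power differentiable_const
          norm_C_vec_differentiable)
  qed
  show "\<forall>\<^sub>F s in nhds 0. ecc (\<Theta> (- s)) chi \<Lambda> (\<theta> (- s)) \<kappa> j = ecc (\<Theta> s) chi \<Lambda> (\<theta> s) \<kappa> j"
    using eventually_admissible by (rule eventually_mono) (simp only: odd ecc_minus[OF _ j])
qed

text \<open>Near 0 the anomaly has a differentiable real lift, whose cosine and sine are those of
  the anomaly.\<close>

lemma kepler_trig_differentiable:
  shows "(\<lambda>s. cos_angle (kepler (ecc (\<Theta> s) chi \<Lambda> (\<theta> s) \<kappa> j) a)) differentiable (at 0)"
    and "(\<lambda>s. sin_angle (kepler (ecc (\<Theta> s) chi \<Lambda> (\<theta> s) \<kappa> j) a)) differentiable (at 0)"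
proof -
  obtain z where z: "(z has_real_derivative 0) (at 0)"
    and ev: "\<forall>\<^sub>F s in nhds 0. kepler (ecc (\<Theta> s) chi \<Lambda> (\<theta> s) \<kappa> j) a = of_radians (z s)"
    using kepler_differentiable[OF ecc_has_derivative_0 ecc_bounds(2,3)[OF start j]] .
  have "\<forall>\<^sub>F s in nhds 0. cos_angle (kepler (ecc (\<Theta> s) chi \<Lambda> (\<theta> s) \<kappa> j) a) = cos (z s)"
    and "\<forall>\<^sub>F s in nhds 0. sin_angle (kepler (ecc (\<Theta> s) chi \<Lambda> (\<theta> s) \<kappa> j) a) = sin (z s)"
    using ev by (rule eventually_mono, simp)+
  from this[THEN DERIV_cong_ev[OF refl _ refl]]
  show "(\<lambda>s. cos_angle (kepler (ecc (\<Theta> s) chi \<Lambda> (\<theta> s) \<kappa> j) a)) differentiable (at 0)"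
    and "(\<lambda>s. sin_angle (kepler (ecc (\<Theta> s) chi \<Lambda> (\<theta> s) \<kappa> j) a)) differentiable (at 0)"
    unfolding real_differentiable_def using DERIV_chain2[OF DERIV_cos z] DERIV_chain2[OF DERIV_sin z]
    by blast+
qed

lemma ecc_differentiable: "(\<lambda>s. ecc (\<Theta> s) chi \<Lambda> (\<theta> s) \<kappa> j) differentiable (at 0)"
  using ecc_has_derivative_0 real_differentiable_def by blast

lemma kepler_x_differentiable:
  "(\<lambda>s. kepler_x a (ecc (\<Theta> s) chi \<Lambda> (\<theta> s) \<kappa> j) (kepler (ecc (\<Theta> s) chi \<Lambda> (\<theta> s) \<kappa> j) b)
      (P_vec (\<Theta> s) chi (\<theta> s) \<kappa> j) (Q_vec (\<Theta> s) chi (\<theta> s) \<kappa> j)) differentiable (at 0)"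
proof -
  have "0 < 1 - (ecc (\<Theta> 0) chi \<Lambda> (\<theta> 0) \<kappa> j)\<^sup>2"
    using ecc_bounds(2,3)[OF start j] by (simp add: power_less_one_iff)
  then have "(\<lambda>s. sqrt (1 - (ecc (\<Theta> s) chi \<Lambda> (\<theta> s) \<kappa> j)\<^sup>2)) differentiable (at 0)"
    by (rule differentiable_DERIV_compose[OF DERIV_real_sqrt])
      (intro differentiable_diff differentiable_power differentiable_const ecc_differentiable)
  then show ?thesis
    unfolding kepler_x_def
    by (intro differentiable_add differentiable_scaleR differentiable_mult differentiable_diff
        differentiable_const ecc_differentiable kepler_trig_differentiable P_vec_differentiable
        Q_vec_differentiable)
qed

lemma kepler_y_differentiable:
  assumes "0 < M" "0 < a"
  shows "(\<lambda>s. kepler_y m M a (ecc (\<Theta> s) chi \<Lambda> (\<theta> s) \<kappa> j) (kepler (ecc (\<Theta> s) chi \<Lambda> (\<theta> s) \<kappa> j) b)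
      (P_vec (\<Theta> s) chi (\<theta> s) \<kappa> j) (Q_vec (\<Theta> s) chi (\<theta> s) \<kappa> j)) differentiable (at 0)"
proof -
  let ?e = "\<lambda>s. ecc (\<Theta> s) chi \<Lambda> (\<theta> s) \<kappa> j"
  note e0 = ecc_bounds(2,3)[OF start j]
  have "0 < 1 - (?e 0)\<^sup>2"
    using e0 by (simp add: power_less_one_iff)
  then have "0 < M * (1 - (?e 0)\<^sup>2) / a"
    using assms by simp
  then have sq: "(\<lambda>s. sqrt (M * (1 - (?e s)\<^sup>2) / a)) differentiable (at 0)"
    by (rule differentiable_DERIV_compose[OF DERIV_real_sqrt])
      (unfold divide_inverse, intro differentiable_mult differentiable_diff differentiable_power
        differentiable_const ecc_differentiable)
  \<comment> \<open>The denominator in the momentum formula is nonzero because the eccentricity lies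
    strictly between 0 and 1.\<close>
  have "?e 0 * cos_angle (kepler (?e 0) b) \<le> ?e 0"
    using e0 by (intro mult_left_le) (simp_all add: cos_angle.rep_eq)
  also have "\<dots> < 1"
    by (rule e0)
  finally have ne: "1 - ?e 0 * cos_angle (kepler (?e 0) b) \<noteq> 0"
    by simp
  show ?thesis
    unfolding kepler_y_def
    by (intro differentiable_add differentiable_scaleR differentiable_mult differentiable_diff
        differentiable_divide differentiable_const ecc_differentiable kepler_trig_differentiable
        P_vec_differentiable Q_vec_differentiable sq ne)
qed

end

lemma P_map_differentiable:
  "(\<lambda>s. P_map \<mm> \<MM> (\<Theta> s, chi, \<Lambda>, \<theta> s, \<kappa>, l)) differentiable (at 0)"
proof -
  have "to_nat_on UNIV p + 1 \<in> {1..CARD('n)}" for p :: 'n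
    using to_nat_on_UNIV_less[of p] by auto
  moreover have "0 < ent \<MM> (to_nat_on UNIV p + 1 - 1)" for p :: 'n
    using to_nat_on_UNIV_less[of p] mass_pos by (simp add: ent_def)
  moreover have "0 < semi_axis \<mm> \<MM> \<Lambda> (to_nat_on UNIV p + 1)" for p :: 'n
  proof -
    have "\<forall>j\<in>{1..CARD('n)}. 0 < ent \<Lambda> (j - 1)"
      using start unfolding X_P_def by blast
    then have "0 < ent \<Lambda> (to_nat_on UNIV p + 1 - 1)"
      using \<open>to_nat_on UNIV p + 1 \<in> {1..CARD('n)}\<close> by blast
    then show ?thesis
      using to_nat_on_UNIV_less[of p] mass_pos[THEN spec, of p]
      by (simp add: semi_axis_def ent_def)
  qed
  ultimately show ?thesis
    unfolding P_map.simps Let_def tuple1_def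
    by (intro differentiable_Pair differentiable_vec_lambda kepler_x_differentiable
        kepler_y_differentiable)
qed

text \<open>Near 0 the curve of images stays in the open set \<open>U\<close>, and the reflected
  parameter gives the reflected image, so the composite is even.\<close>

lemma invariant_hamiltonian_has_derivative_0:
  assumes H: "hamiltonian U H" "\<forall>z\<in>U. H (R2_minus z) = H z"
    and U: "P_map \<mm> \<MM> (\<Theta> 0, chi, \<Lambda>, \<theta> 0, \<kappa>, l) \<in> U"
  shows "((\<lambda>s. H (P_map \<mm> \<MM> (\<Theta> s, chi, \<Lambda>, \<theta> s, \<kappa>, l))) has_real_derivative 0) (at 0)"
proof (rule has_real_derivative_0_of_even)
  let ?\<Phi> = "\<lambda>s. P_map \<mm> \<MM> (\<Theta> s, chi, \<Lambda>, \<theta> s, \<kappa>, l)"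
  have "Ck_on (Suc 0) U H"
    using H(1) unfolding hamiltonian_def smooth_on_def by blast
  then have "H differentiable (at (?\<Phi> 0))"
    using U by simp
  then show "(\<lambda>s. H (?\<Phi> s)) differentiable (at 0)"
    by (rule differentiable_compose[OF _ P_map_differentiable])
  have "isCont ?\<Phi> 0"
    by (rule differentiable_imp_continuous_within[OF P_map_differentiable])
  then have "(?\<Phi> \<longlongrightarrow> ?\<Phi> 0) (at 0)"
    by (simp add: isCont_def)
  then have "\<forall>\<^sub>F s in at 0. ?\<Phi> s \<in> U"
    by (rule topological_tendstoD) (use H(1) U in \<open>simp_all add: hamiltonian_def\<close>)
  then have "\<forall>\<^sub>F s in nhds 0. ?\<Phi> s \<in> U"
    using U by (simp only: eventually_nhds_conv_at simp_thms)
  with eventually_admissible show "\<forall>\<^sub>F s in nhds 0. H (?\<Phi> (- s)) = H (?\<Phi> s)"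
  proof eventually_elim
    case (elim s)
    then have "?\<Phi> (- s) = R2_minus (?\<Phi> s)"
      unfolding odd by (intro P_map_minus)
    with elim H(2) show ?case by simp
  qed
qed

end

section \<open>Symmetry of the domain, the intertwining relation and the equilibria\<close>

lemma S_minus_P_domain: "S_minus p \<in> P_domain \<longleftrightarrow> p \<in> P_domain"
  \<comment> \<open>The conditions of \<open>X_P\<close> depend on \<Theta> through absolute values
    and squares, and on \<theta> through its cosine and the exclusion of \<open>pi\<close>, which is
    its own negative.\<close>
  by (cases p) (simp add: P_domain_def X_P_def minus_eq_of_radians_pi_iff)

lemma P_map_S_minus:
  assumes "p \<in> P_domain"
  shows "P_map \<mm> \<MM> (S_minus p) = R2_minus (P_map \<mm> \<MM> p)"
proof (cases p)
  case (fields \<Theta> chi \<Lambda> \<theta> \<kappa> l)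
  then have "admissible \<Theta> chi"
    using assms X_P_admissible unfolding P_domain_def by blast
  then show ?thesis
    unfolding fields S_minus.simps by (rule P_map_minus)
qed

text \<open>Since \<theta> is its own negative, the lines through the base point in both kinds of
  coordinate directions are odd curves.\<close>

lemma equilibrium_of_invariant:
  fixes \<mm> \<MM> :: "real^'n::finite"
  assumes mass: "\<forall>p. 0 < \<mm> $ p" "\<forall>p. 0 < \<MM> $ p"
    and H: "hamiltonian U H" "\<forall>z\<in>U. H (R2_minus z) = H z" and \<theta>: "- \<theta> = \<theta>"
  shows "equilibrium (HP_domain \<mm> \<MM> U) (H \<circ> P_map \<mm> \<MM>) 0 \<theta>"
  unfolding equilibrium_def
proof (intro allI impI conjI)
  fix chi \<Lambda> \<kappa> l p
  assume D: "(0, chi, \<Lambda>, \<theta>, \<kappa>, l) \<in> HP_domain \<mm> \<MM> U"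
  then have X: "(0, chi, \<Lambda>, \<theta>, \<kappa>) \<in> X_P" and U: "P_map \<mm> \<MM> (0, chi, \<Lambda>, \<theta>, \<kappa>, l) \<in> U"
    by (simp_all add: HP_domain_def P_domain_def)
  have axis_0: "axis p (0 :: 'b::zero) = 0" for p :: 'n
    by (simp add: vec_eq_iff axis_def)
  interpret \<Theta>: odd_curve \<mm> \<MM> chi \<Lambda> \<kappa> l "\<lambda>s. 0 + axis p s" "\<lambda>s. \<theta>"
  proof
    fix i
    show "(\<lambda>s. ent (0 + axis p s :: real^'n) i) differentiable (at 0)"
      by (cases "i < CARD('n)"; cases "from_nat_into UNIV i = p") (simp_all add: ent_def axis_def)
  next
    fix s :: real
    show "0 + axis p (- s) = - (0 + axis p s)"
      by (simp add: vec_eq_iff axis_def)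
  qed (use mass \<theta> X in \<open>simp_all add: axis_0\<close>)
  show "((\<lambda>s. (H \<circ> P_map \<mm> \<MM>) (0 + axis p s, chi, \<Lambda>, \<theta>, \<kappa>, l)) has_real_derivative 0) (at 0)"
    using \<Theta>.invariant_hamiltonian_has_derivative_0[OF H] U by (simp add: axis_0)
  interpret \<theta>: odd_curve \<mm> \<MM> chi \<Lambda> \<kappa> l "\<lambda>s. 0" "\<lambda>s. \<theta> + axis p (of_radians s)"
  proof
    fix i
    \<comment> \<open>Splitting off the moving part as a real lift lets the addition formulas reduce
      the claim to real cosine and sine.\<close>
    have *: "ent (\<theta> + axis p (of_radians s)) i
      = ent \<theta> i + of_radians (if i < CARD('n) \<and> from_nat_into UNIV i = p then s else 0)" for s
      by (simp add: ent_def axis_def)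
    have "(\<lambda>s :: real. if i < CARD('n) \<and> from_nat_into UNIV i = p then s else 0) differentiable (at 0)"
      by (cases "i < CARD('n)"; cases "from_nat_into UNIV i = p") simp_all
    note d = differentiable_DERIV_compose[OF DERIV_cos this] differentiable_DERIV_compose[OF DERIV_sin this]
    show "(\<lambda>s. cos_angle (ent (\<theta> + axis p (of_radians s)) i)) differentiable (at 0)"
      and "(\<lambda>s. sin_angle (ent (\<theta> + axis p (of_radians s)) i)) differentiable (at 0)"
      unfolding * cos_angle_add sin_angle_add cos_angle_of_radians sin_angle_of_radians
      by (intro differentiable_add differentiable_diff differentiable_mult differentiable_const d)+
  next
    fix s
    have "- \<theta> $ q = \<theta> $ q" for q
      using \<theta> by (metis vector_uminus_component)
    then show "\<theta> + axis p (of_radians (- s)) = - (\<theta> + axis p (of_radians s))"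
      by (auto simp: vec_eq_iff axis_def of_radians_minus)
  qed (use mass X in \<open>simp_all add: axis_0\<close>)
  show "((\<lambda>s. (H \<circ> P_map \<mm> \<MM>) (0, chi, \<Lambda>, \<theta> + axis p (of_radians s), \<kappa>, l)) has_real_derivative 0) (at 0)"
    using \<theta>.invariant_hamiltonian_has_derivative_0[OF H] U by (simp add: axis_0)
qed

theorem proposition2p17:
  fixes \<mm> \<MM> :: "real^'n"
  assumes "\<forall>p. 0 < \<mm> $ p" and "\<forall>p. 0 < \<MM> $ p"
  shows "(S_minus -` (P_domain :: 'n coords set) = P_domain \<and>
          (\<forall>p\<in>P_domain. (R2_minus \<circ> P_map \<mm> \<MM>) p = (P_map \<mm> \<MM> \<circ> S_minus) p)) \<and>
         (\<forall>U (H :: 'n phase \<Rightarrow> real).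
            hamiltonian U H \<and> R2_minus -` U = U \<and> (\<forall>z\<in>U. (H \<circ> R2_minus) z = H z) \<longrightarrow>
              (S_minus -` HP_domain \<mm> \<MM> U = HP_domain \<mm> \<MM> U \<and>
               (\<forall>p\<in>HP_domain \<mm> \<MM> U. (H \<circ> P_map \<mm> \<MM> \<circ> S_minus) p = (H \<circ> P_map \<mm> \<MM>) p)) \<and>
              (\<forall>k :: int^'n. equilibrium (HP_domain \<mm> \<MM> U) (H \<circ> P_map \<mm> \<MM>)
                 0 (\<chi> p. of_radians (of_int (k $ p) * pi))))"
proof (intro conjI allI impI)
  show "S_minus -` (P_domain :: 'n coords set) = P_domain"
    by (intro set_eqI) (simp add: S_minus_P_domain)
  show "\<forall>p\<in>P_domain. (R2_minus \<circ> P_map \<mm> \<MM>) p = (P_map \<mm> \<MM> \<circ> S_minus) p"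
    by (simp add: P_map_S_minus)
next
  fix U and H :: "'n phase \<Rightarrow> real" and k :: "int^'n"
  assume *: "hamiltonian U H \<and> R2_minus -` U = U \<and> (\<forall>z\<in>U. (H \<circ> R2_minus) z = H z)"
  then have U: "R2_minus z \<in> U \<longleftrightarrow> z \<in> U" for z
    by blast
  show "S_minus -` HP_domain \<mm> \<MM> U = HP_domain \<mm> \<MM> U"
    by (intro set_eqI) (auto simp: HP_domain_def S_minus_P_domain P_map_S_minus U
        simp del: S_minus.simps P_map.simps)
  show "\<forall>p\<in>HP_domain \<mm> \<MM> U. (H \<circ> P_map \<mm> \<MM> \<circ> S_minus) p = (H \<circ> P_map \<mm> \<MM>) p"
    using * by (simp add: HP_domain_def P_map_S_minus)
  \<comment> \<open>The candidate points are fixed by \<open>S_minus\<close>.\<close>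
  have "- (\<chi> p. of_radians (of_int (k $ p) * pi)) = (\<chi> p. of_radians (of_int (k $ p) * pi))"
    by (simp add: vec_eq_iff minus_of_radians_multiple_pi)
  with assms * show "equilibrium (HP_domain \<mm> \<MM> U) (H \<circ> P_map \<mm> \<MM>)
      0 (\<chi> p. of_radians (of_int (k $ p) * pi))"
    by (intro equilibrium_of_invariant) auto
qed

end
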